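(* Let $q$ be a prime power, let $d$ be a positive integer, and let $k \in \{1,2,\ldots,d-1\}$. Let $E \subset \mathbb{F}_q^d$ be a set with $30q^k \leq |E| \leq q^{k+1}$, and let $M$ be an integer with $|E|q^{-1} \leq M \leq 4^{-1}q^k$. Then $$\#\{y \in \mathbb{F}_q^d : |\pi^y(E)| \leq M\} < 300\,q^k M |E|^{-1}.$$
   Context: $\mathbb{F}_q$ denotes the finite field with $q$ elements and $\mathbb{F}_q^d$ the $d$-dimensional vector space over it. A line is an affine line (a translate of a $1$-dimensional linear subspace of $\mathbb{F}_q^d$). For a point $y \in \mathbb{F}_q^d$, the radial projection $\pi^y$ maps each point $x \in \mathbb{F}_q^d \setminus \{y\}$ to the unique line containing $x$ and $y$. For a set $E \subset \mathbb{F}_q^d$, $\pi^y(E)$ denotes the set of lines $\{\pi^y(x) : x \in E \setminus \{y\}\}$, and $|\pi^y(E)|$ is the number of distinct lines in this set (i.e. the number of lines through $y$ that contain at least one point of $E$ other than $y$). *)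

theory Defs
  imports "HOL-Analysis.Cartesian_Space"
begin

text \<open>
  The field with \<open>q\<close> elements is a type \<open>'a :: {field, finite}\<close> with \<open>CARD('a) = q\<close>, and the
  \<open>d\<close>-dimensional space over it is \<open>'a ^ 'd\<close> with \<open>CARD('d) = d\<close>. The prefix \<open>vec\<close> refers to linear
  algebra over an arbitrary field with scalar multiplication \<open>*s\<close>, not over the reals.
\<close>

definition is_line :: "('a::field ^ 'd) set \<Rightarrow> bool" where
  "is_line L \<longleftrightarrow> (\<exists>a V. vec.subspace V \<and> vec.dim V = 1 \<and> L = (+) a ` V)"

text \<open>Only meaningful for \<open>x \<noteq> y\<close>; see \<open>ex1_line\<close> below.\<close>

definition radial_projection :: "'a::field ^ 'd \<Rightarrow> 'a ^ 'd \<Rightarrow> ('a ^ 'd) set" where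
  "radial_projection y x = (THE L. is_line L \<and> x \<in> L \<and> y \<in> L)"

definition radial_image :: "'a::field ^ 'd \<Rightarrow> ('a ^ 'd) set \<Rightarrow> ('a ^ 'd) set set" where
  "radial_image y E = radial_projection y ` (E - {y})"

lemma ex1_line:
  fixes x y :: "'a::field ^ 'd"
  assumes "x \<noteq> y"
  shows "\<exists>!L. is_line L \<and> x \<in> L \<and> y \<in> L"
proof (rule ex1I)
  let ?S = "vec.span {x - y}"
  have ind: "vec.independent {x - y}"
    using assms by simp
  have "vec.dim ?S = 1"
    using vec.dim_eq_card_independent[OF ind] by simp
  then have "is_line ((+) y ` ?S)"
    unfolding is_line_def by (metis vec.subspace_span)
  moreover have "x \<in> (+) y ` ?S"
    by (rule image_eqI[of _ _ "x - y"]) (auto intro: vec.span_base)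
  moreover have "y \<in> (+) y ` ?S"
    by (rule image_eqI[of _ _ 0]) (auto intro: vec.span_zero)
  ultimately show "is_line ((+) y ` ?S) \<and> x \<in> (+) y ` ?S \<and> y \<in> (+) y ` ?S"
    by blast
next
  fix L
  assume L: "is_line L \<and> x \<in> L \<and> y \<in> L"
  then obtain a V where V: "vec.subspace V" "vec.dim V = 1" "L = (+) a ` V"
    unfolding is_line_def by blast
  obtain u v where uv: "u \<in> V" "v \<in> V" "x = a + u" "y = a + v"
    using L V(3) by blast
  have ind: "vec.independent {x - y}"
    using assms by simp
  have xy: "x - y \<in> V"
    using vec.subspace_diff[OF V(1) uv(1,2)] uv(3,4) by simp
  have span: "V = vec.span {x - y}"
  proof
    show "V \<subseteq> vec.span {x - y}"
      using vec.card_ge_dim_independent[of "{x - y}" V] ind xy V(2) by simp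
    show "vec.span {x - y} \<subseteq> V"
      using vec.span_minimal[of "{x - y}" V] xy V(1) by simp
  qed
  have "L = (+) y ` V"
  proof (intro set_eqI iffI)
    fix z assume "z \<in> L"
    then obtain w where w: "w \<in> V" "z = a + w"
      using V(3) by blast
    then have "w - v \<in> V" "z = y + (w - v)"
      using vec.subspace_diff[OF V(1)] uv by auto
    then show "z \<in> (+) y ` V" by blast
  next
    fix z assume "z \<in> (+) y ` V"
    then obtain w where w: "w \<in> V" "z = y + w" by blast
    then have "v + w \<in> V" "z = a + (v + w)"
      using vec.subspace_add[OF V(1)] uv by (auto simp: add.assoc)
    then show "z \<in> L" using V(3) by blast
  qed
  then show "L = (+) y ` vec.span {x - y}"
    using span by simp
qed

end

theory Submission
  imports Defs "HOL-Analysis.Convex"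
begin

text \<open>
  First let the ambient space be \<open>(k + 1)\<close>-dimensional. If every \<open>y \<in> Y\<close> has at most \<open>M \<le> q\<^sup>k / 4\<close> lines
  covering \<open>E\<close>, then these lines carry far more points of \<open>E\<close> than the average \<open>|E| / q\<^sup>k\<close>. The total
  excess is at least \<open>3/4 |Y| |E|\<close>; on the other hand Cauchy--Schwarz bounds it by the variance
  of \<open>|E \<inter> l|\<close> over all lines (about \<open>q\<^sup>k |E|\<close>) and by the second moment of the number of \<open>y \<in> Y\<close> that
  selected \<open>l\<close> (at most \<open>|Y| M + |Y|\<^sup>2\<close>, since two points share a single line). As \<open>|E|\<close> is
  large compared with \<open>q\<^sup>k\<close>, the \<open>|Y|\<^sup>2\<close> term is absorbed.

  In general, apply a random linear map into a \<open>(k + 1)\<close>-dimensional coordinate subspace. Such a map does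
  not increase radial images, and since it has few collisions on average, some choice keeps
  a quarter of \<open>E\<close> and a quarter of a suitable subset of \<open>Y\<close>.
\<close>

section \<open>Second moments and incidences in regular linear spaces\<close>

text \<open>A square counts ordered pairs, and the sums are exchanged. It serves for points of
  \<open>E\<close> on a block, for points of \<open>Y\<close> selecting a block, and for fibres of a
  map.\<close>

lemma sum_card_square:
  fixes R :: "'b \<Rightarrow> 'c \<Rightarrow> bool"
  assumes "finite B" "finite A"
  shows "(\<Sum>l\<in>B. (real (card {x \<in> A. R l x}))\<^sup>2)
    = (\<Sum>x\<in>A. \<Sum>y\<in>A. real (card {l \<in> B. R l x \<and> R l y}))"
proof -
  have *: "real (card {z \<in> S. Q z}) = (\<Sum>z\<in>S. of_bool (Q z))" if "finite S" for S :: "'z set" and Q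
    using that by (simp add: of_bool_def sum.If_cases Int_def)
  have "(\<Sum>l\<in>B. (real (card {x \<in> A. R l x}))\<^sup>2)
      = (\<Sum>l\<in>B. \<Sum>x\<in>A. \<Sum>y\<in>A. of_bool (R l x \<and> R l y))"
    unfolding *[OF assms(2)] power2_eq_square sum_product of_bool_conj ..
  also have "\<dots> = (\<Sum>x\<in>A. \<Sum>l\<in>B. \<Sum>y\<in>A. of_bool (R l x \<and> R l y))"
    by (rule sum.swap)
  also have "\<dots> = (\<Sum>x\<in>A. \<Sum>y\<in>A. \<Sum>l\<in>B. of_bool (R l x \<and> R l y))"
    by (intro sum.cong refl sum.swap)
  finally show ?thesis
    unfolding *[OF assms(1)] .
qed

text \<open>Linear spaces in the sense of incidence geometry, not of linear algebra.\<close>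

locale regular_linear_space =
  fixes P :: "'p set" and B :: "'p set set" and q r :: nat
  assumes finite_points: "finite P"
    and block_subset: "l \<in> B \<Longrightarrow> l \<subseteq> P"
    and card_block: "l \<in> B \<Longrightarrow> card l = q"
    and ex1_block: "x \<in> P \<Longrightarrow> y \<in> P \<Longrightarrow> x \<noteq> y \<Longrightarrow> \<exists>!l. l \<in> B \<and> x \<in> l \<and> y \<in> l"
    and degree: "x \<in> P \<Longrightarrow> card {l \<in> B. x \<in> l} = r"
    and q_pos: "0 < q"
begin

lemma finite_blocks: "finite B"
  using block_subset finite_points by (meson finite_Pow_iff finite_subset PowI subsetI)

lemma sum_card_Int_blocks:
  assumes "E \<subseteq> P"
  shows "(\<Sum>l\<in>B. card {x \<in> E. x \<in> l}) = r * card E"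
  using assms finite_points finite_blocks degree
  by (intro sum_multicount) (auto intro: finite_subset)

lemma card_blocks: "card B * q = r * card P"
proof -
  have "{x \<in> P. x \<in> l} = l" if "l \<in> B" for l
    using block_subset that by blast
  then show ?thesis
    using sum_card_Int_blocks[of P] card_block by simp
qed

lemma pair_degree:
  assumes "x \<in> P" "y \<in> P" "x \<noteq> y"
  shows "card {l \<in> B. x \<in> l \<and> y \<in> l} = 1"
proof -
  obtain l where "l \<in> B \<and> x \<in> l \<and> y \<in> l" "\<And>l'. l' \<in> B \<and> x \<in> l' \<and> y \<in> l' \<Longrightarrow> l' = l"
    using ex1_block[OF assms] by blast
  then have "{l \<in> B. x \<in> l \<and> y \<in> l} = {l}"
    by blast
  then show ?thesis by simp
qed

text \<open>
  The mean of \<open>card (E \<inter> l)\<close> over all blocks \<open>l\<close> is \<open>card E * q / card P\<close>, by \<open>card_blocks\<close>.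
\<close>

lemma variance_le:
  assumes E: "E \<subseteq> P" and r: "card P \<le> q * r"
  shows "(\<Sum>l\<in>B. (real (card {x \<in> E. x \<in> l}) - card E * q / card P)\<^sup>2) \<le> real (card E) * r"
proof (cases "E = {}")
  case True
  then show ?thesis by simp
next
  case False
  have fin: "finite E" using E finite_points by (rule finite_subset)
  have P: "0 < card P" using E False finite_points by (simp add: card_gt_0_iff) blast
  define e where "e = real (card E)"
  define c where "c = e * q / card P"
  have e: "1 \<le> e"
    using fin False by (simp add: e_def Suc_le_eq card_gt_0_iff)
  have s1: "(\<Sum>l\<in>B. real (card {x \<in> E. x \<in> l})) = r * e"
    using arg_cong[OF sum_card_Int_blocks[OF E], of real] by (simp add: e_def)
  \<comment> \<open>The point \<open>x\<close> shares all its \<open>r\<close> blocks with itself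
    and exactly one with each of the other \<open>e - 1\<close> points of \<open>E\<close>.\<close>
  have inner: "(\<Sum>y\<in>E. real (card {l \<in> B. x \<in> l \<and> y \<in> l})) = r + (e - 1)" if x: "x \<in> E" for x
  proof -
    have "(\<Sum>y\<in>E. real (card {l \<in> B. x \<in> l \<and> y \<in> l}))
        = real (card {l \<in> B. x \<in> l \<and> x \<in> l}) + (\<Sum>y\<in>E - {x}. real (card {l \<in> B. x \<in> l \<and> y \<in> l}))"
      using fin x by (rule sum.remove)
    also have "(\<Sum>y\<in>E - {x}. real (card {l \<in> B. x \<in> l \<and> y \<in> l})) = (\<Sum>y\<in>E - {x}. 1)"
      using E x by (intro sum.cong refl) (subst pair_degree, auto)
    also have "\<dots> = e - 1"
      using fin x e by (simp add: e_def card_Diff_singleton of_nat_diff)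
    also have "card {l \<in> B. x \<in> l \<and> x \<in> l} = r"
      using degree E x by auto
    finally show ?thesis .
  qed
  have s2: "(\<Sum>l\<in>B. (real (card {x \<in> E. x \<in> l}))\<^sup>2) = e * (r + (e - 1))"
    using sum_card_square[OF finite_blocks fin, of "\<lambda>l x. x \<in> l"] inner by (simp add: e_def)
  have B: "real (card B) = r * card P / q"
    using arg_cong[OF card_blocks, of real] q_pos by (simp add: field_simps)
  have "(\<Sum>l\<in>B. (real (card {x \<in> E. x \<in> l}) - c)\<^sup>2)
      = (\<Sum>l\<in>B. (real (card {x \<in> E. x \<in> l}))\<^sup>2) - 2 * c * (\<Sum>l\<in>B. real (card {x \<in> E. x \<in> l}))
        + card B * c\<^sup>2"
    by (simp add: power2_diff sum.distrib sum_subtractf sum_distrib_left mult_ac)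
  also have "\<dots> = e * r + e * (e - 1) - e\<^sup>2 * (r * q / card P)"
    unfolding s1 s2 B c_def using P q_pos by (simp add: field_simps power2_eq_square)
  \<comment> \<open>The hypothesis \<open>r\<close> makes the subtracted term at least the square of
    \<open>e\<close>, which outweighs \<open>e * (e - 1)\<close> and leaves only the diagonal
    contribution \<open>e * r\<close>.\<close>
  also have "\<dots> \<le> e * r"
  proof -
    have "real (card P) \<le> q * r"
      using r by (metis of_nat_le_iff of_nat_mult)
    then have "1 \<le> r * q / card P"
      using P by (simp add: field_simps)
    then have "e\<^sup>2 * 1 \<le> e\<^sup>2 * (r * q / card P)"
      by (intro mult_left_mono) auto
    then show ?thesis
      using e by (simp add: algebra_simps power2_eq_square)
  qed
  finally show ?thesis
    by (simp add: c_def e_def)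
qed

text \<open>Here \<open>F y\<close> stands for the lines of a radial projection. Summing the excess
  \<open>f l - c\<close> over all selections equals summing it over all blocks with weight
  \<open>m l\<close>; Cauchy-Schwarz then separates the weights, which depend on \<open>Y\<close>,
  from the deviations, which depend on \<open>E\<close>.\<close>

lemma few_blocks_cover:
  fixes M :: real
  assumes E: "E \<subseteq> P" and Y: "Y \<subseteq> P" and r: "card P \<le> q * r"
    and F: "\<And>y. y \<in> Y \<Longrightarrow> F y \<subseteq> {l \<in> B. y \<in> l}"
    and cover: "\<And>y. y \<in> Y \<Longrightarrow> E \<subseteq> \<Union>(F y)"
    and card_F: "\<And>y. y \<in> Y \<Longrightarrow> card (F y) \<le> M"
    and M: "0 \<le> M" "M * q \<le> card P" and P: "P \<noteq> {}"
  shows "(real (card Y) * card E * (1 - M * q / card P))\<^sup>2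
    \<le> (card Y * M + (real (card Y))\<^sup>2) * (real (card E) * r)"
proof -
  have fin: "finite E" "finite Y" using E Y finite_points finite_subset by blast+
  have finF: "finite (F y)" if "y \<in> Y" for y
    using F[OF that] finite_blocks by (auto intro: finite_subset)
  have P0: "0 < card P" using P finite_points by (simp add: card_gt_0_iff)
  define c where "c = real (card E) * q / card P"
  define f where "f l = real (card {x \<in> E. x \<in> l})" for l
  define m where "m l = real (card {y \<in> Y. l \<in> F y})" for l
  have c: "0 \<le> c" by (simp add: c_def)
  have sm: "(\<Sum>l\<in>B. m l * g l) = (\<Sum>y\<in>Y. \<Sum>l\<in>F y. g l)" for g :: "'p set \<Rightarrow> real"
  proof -
    have "(\<Sum>y\<in>Y. \<Sum>l\<in>F y. g l) = (\<Sum>y\<in>Y. \<Sum>l\<in>{l \<in> B. l \<in> F y}. g l)"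
      using F by (intro sum.cong refl) auto
    also have "\<dots> = (\<Sum>l\<in>B. \<Sum>y\<in>{y \<in> Y. l \<in> F y}. g l)"
      using fin(2) finite_blocks by (rule sum.swap_restrict)
    finally show ?thesis
      by (simp add: m_def)
  qed
  \<comment> \<open>Covering forces the selected blocks to carry all of \<open>E\<close>, whereas at
    most \<open>M\<close> blocks of average size \<open>c\<close> would carry only the fraction
    \<open>M * q / card P\<close> of it.\<close>
  have lower: "card E * (1 - M * q / card P) \<le> (\<Sum>l\<in>F y. f l - c)" if y: "y \<in> Y" for y
  proof -
    have "card E \<le> card (\<Union>l\<in>F y. {x \<in> E. x \<in> l})"
      using cover[OF y] fin finF[OF y] by (intro card_mono) auto
    also have "\<dots> \<le> (\<Sum>l\<in>F y. card {x \<in> E. x \<in> l})"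
      using finF[OF y] by (rule card_UN_le)
    finally have "real (card E) \<le> (\<Sum>l\<in>F y. f l)"
      unfolding f_def by (simp flip: of_nat_sum)
    moreover have "card (F y) * c \<le> M * c"
      using card_F[OF y] c by (rule mult_right_mono)
    ultimately show ?thesis
      by (simp add: sum_subtractf c_def algebra_simps)
  qed
  have "card Y * (card E * (1 - M * q / card P)) \<le> (\<Sum>y\<in>Y. \<Sum>l\<in>F y. f l - c)"
    using sum_mono[OF lower] by simp
  then have "real (card Y) * card E * (1 - M * q / card P) \<le> (\<Sum>l\<in>B. m l * (f l - c))"
    by (simp add: sm mult_ac)
  moreover have "0 \<le> real (card Y) * card E * (1 - M * q / card P)"
    using M P0 by (intro mult_nonneg_nonneg) (auto simp: field_simps)
  ultimately have "(real (card Y) * card E * (1 - M * q / card P))\<^sup>2 \<le> (\<Sum>l\<in>B. m l * (f l - c))\<^sup>2"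
    by (rule power_mono)
  also have "\<dots> \<le> (\<Sum>l\<in>B. (m l)\<^sup>2) * (\<Sum>l\<in>B. (f l - c)\<^sup>2)"
    by (rule Cauchy_Schwarz_ineq_sum)
  also have "\<dots> \<le> (card Y * M + (real (card Y))\<^sup>2) * (real (card E) * r)"
  proof (rule mult_mono)
    \<comment> \<open>A block selected by two distinct points is the unique block joining them, so
      an off-diagonal term is at most 1; the diagonal term is at most \<open>M\<close>, and adding 1
      there too only simplifies the total.\<close>
    have "(\<Sum>z\<in>Y. real (card {l \<in> B. l \<in> F y \<and> l \<in> F z})) \<le> M + card Y" if y: "y \<in> Y" for y
    proof -
      have "(\<Sum>z\<in>Y. real (card {l \<in> B. l \<in> F y \<and> l \<in> F z})) \<le> (\<Sum>z\<in>Y. (if z = y then M else 0) + 1)"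
      proof (rule sum_mono)
        fix z assume z: "z \<in> Y"
        show "real (card {l \<in> B. l \<in> F y \<and> l \<in> F z}) \<le> (if z = y then M else 0) + 1"
        proof (cases "z = y")
          case True
          have "{l \<in> B. l \<in> F y \<and> l \<in> F z} = F y" using True F[OF y] by auto
          then show ?thesis using True card_F[OF y] by simp
        next
          case False
          have "card {l \<in> B. l \<in> F y \<and> l \<in> F z} \<le> card {l \<in> B. y \<in> l \<and> z \<in> l}"
            using F[OF y] F[OF z] finite_blocks by (intro card_mono) auto
          also have "\<dots> = 1" using False y z Y by (intro pair_degree) auto
          finally show ?thesis using False by simp
        qed
      qed
      also have "\<dots> = M + card Y"
        using fin y by (simp add: sum.distrib)
      finally show ?thesis .
    qed
    then have "(\<Sum>y\<in>Y. \<Sum>z\<in>Y. real (card {l \<in> B. l \<in> F y \<and> l \<in> F z})) \<le> (\<Sum>y\<in>Y. M + card Y)"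
      by (rule sum_mono)
    then show "(\<Sum>l\<in>B. (m l)\<^sup>2) \<le> card Y * M + (real (card Y))\<^sup>2"
      unfolding m_def sum_card_square[OF finite_blocks fin(2)]
      by (simp add: algebra_simps power2_eq_square)
    show "(\<Sum>l\<in>B. (f l - c)\<^sup>2) \<le> real (card E) * r"
      using variance_le[OF E r] by (simp add: f_def c_def)
  qed (use M in \<open>auto intro: sum_nonneg\<close>)
  finally show ?thesis .
qed

end

section \<open>Lines over a finite field, and subspaces as regular linear spaces\<close>

lemma is_line_iff:
  fixes L :: "('a::field ^ 'd) set"
  shows "is_line L \<longleftrightarrow> (\<exists>y u. u \<noteq> 0 \<and> L = range (\<lambda>c. y + c *s u))"
proof
  assume "is_line L"
  then obtain a V where V: "vec.subspace V" "vec.dim V = 1" "L = (+) a ` V"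
    unfolding is_line_def by blast
  obtain b where b: "b \<subseteq> V" "vec.independent b" "V \<subseteq> vec.span b" "card b = 1"
    using vec.basis_exists[of V] V(2) by metis
  obtain u where u: "b = {u}" using b(4) card_1_singletonE by blast
  have "u \<noteq> 0" using b(2) u by auto
  moreover have "V = vec.span {u}"
    using b u V(1) vec.span_minimal[of b V] by auto
  ultimately show "\<exists>y u. u \<noteq> 0 \<and> L = range (\<lambda>c. y + c *s u)"
    using V(3) by (auto simp: vec.span_singleton image_image)
next
  assume "\<exists>y u. u \<noteq> 0 \<and> L = range (\<lambda>c. y + c *s u)"
  then obtain y u where u: "u \<noteq> 0" "L = range (\<lambda>c. y + c *s u)" by blast
  have "vec.dim (vec.span {u}) = 1"
    using vec.dim_eq_card_independent[of "{u}"] u(1) by simp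
  moreover have "L = (+) y ` vec.span {u}"
    using u(2) by (auto simp: vec.span_singleton image_image)
  ultimately show "is_line L"
    unfolding is_line_def by (metis vec.subspace_span)
qed

lemma radial_projection_eq:
  fixes x y :: "'a::field ^ 'd"
  assumes "x \<noteq> y"
  shows "radial_projection y x = range (\<lambda>c. y + c *s (x - y))"
  unfolding radial_projection_def
proof (rule the1_equality[OF ex1_line[OF assms]], intro conjI)
  show "is_line (range (\<lambda>c. y + c *s (x - y)))"
    using assms unfolding is_line_iff by (metis eq_iff_diff_eq_0)
  show "x \<in> range (\<lambda>c. y + c *s (x - y))"
    by (rule image_eqI[of _ _ 1]) auto
  show "y \<in> range (\<lambda>c. y + c *s (x - y))"
    by (rule image_eqI[of _ _ 0]) auto
qed

lemma ex1_unique: "\<exists>!x. Q x \<Longrightarrow> Q x \<Longrightarrow> Q y \<Longrightarrow> x = y"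
  by blast

lemma radial_projection_line:
  fixes x y :: "'a::field ^ 'd"
  assumes "x \<noteq> y"
  shows "is_line (radial_projection y x) \<and> x \<in> radial_projection y x \<and> y \<in> radial_projection y x"
  unfolding radial_projection_def using theI'[OF ex1_line[OF assms]] .

lemma radial_projection_subset:
  fixes W :: "('a::field ^ 'd) set"
  assumes "vec.subspace W" "x \<in> W" "y \<in> W" "x \<noteq> y"
  shows "radial_projection y x \<subseteq> W"
  using assms
  by (auto simp: radial_projection_eq intro!: vec.subspace_add vec.subspace_scale vec.subspace_diff)

lemma card_line:
  fixes L :: "('a::{field, finite} ^ 'd) set"
  assumes "is_line L"
  shows "card L = CARD('a)"
proof -
  obtain y u where u: "u \<noteq> 0" "L = range (\<lambda>c. y + c *s u)"
    using assms is_line_iff by blast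
  have "inj (\<lambda>c. y + c *s u)"
    using u(1) by (auto intro!: injI)
  then show ?thesis
    by (simp add: u(2) card_image)
qed

lemma two_le_card_field: "2 \<le> CARD('a::{field, finite})"
proof -
  have "card {0, 1 :: 'a} \<le> CARD('a)"
    by (rule card_mono) auto
  then show ?thesis
    by (metis card_2_iff zero_neq_one)
qed

text \<open>For the degree, the lines through \<open>x\<close> with \<open>x\<close> removed
  partition the rest of \<open>W\<close> into classes of size q - 1, where q is the order of the
  field.\<close>

lemma regular_linear_space_subspace:
  fixes W :: "('a::{field, finite} ^ 'd) set"
  assumes W: "vec.subspace W"
  shows "regular_linear_space W {L. is_line L \<and> L \<subseteq> W} CARD('a) ((card W - 1) div (CARD('a) - 1))"
proof
  let ?B = "{L. is_line L \<and> L \<subseteq> W}"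
  show ex1: "\<exists>!l. l \<in> ?B \<and> x \<in> l \<and> y \<in> l" if xy: "x \<in> W" "y \<in> W" "x \<noteq> y" for x y
  proof -
    have "radial_projection y x \<in> ?B \<and> x \<in> radial_projection y x \<and> y \<in> radial_projection y x"
      using radial_projection_line[OF xy(3)] radial_projection_subset[OF W xy] by simp
    moreover have "l = l'" if "l \<in> ?B \<and> x \<in> l \<and> y \<in> l" "l' \<in> ?B \<and> x \<in> l' \<and> y \<in> l'" for l l'
      using that ex1_unique[OF ex1_line[OF xy(3)]] by simp
    ultimately show ?thesis
      by (intro ex1I)
  qed
  fix x assume x: "x \<in> W"
  show "card {l \<in> ?B. x \<in> l} = (card W - 1) div (CARD('a) - 1)"
  proof -
    let ?S = "{l \<in> ?B. x \<in> l}"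
    have cover: "\<exists>l\<in>?S. y \<in> l" if "y \<in> W" "y \<noteq> x" for y
      using ex1_implies_ex[OF ex1[OF x that(1) that(2)[symmetric]]] by blast
    have unique: "l = l'" if "l \<in> ?S" "l' \<in> ?S" "y \<in> l" "y \<in> l'" "y \<noteq> x" for l l' y
    proof -
      have "y \<in> W" using that by blast
      then show ?thesis
        using that ex1_unique[OF ex1[OF x _ that(5)[symmetric]]] by simp
    qed
    have "W - {x} = (\<Union>l\<in>?S. l - {x})"
      using cover by blast
    then have "card W - 1 = card (\<Union>l\<in>?S. l - {x})"
      using x by (metis card_Diff_singleton)
    also have "\<dots> = (\<Sum>l\<in>?S. card (l - {x}))"
    proof (rule card_UN_disjoint)
      show "\<forall>i\<in>?S. \<forall>j\<in>?S. i \<noteq> j \<longrightarrow> (i - {x}) \<inter> (j - {x}) = {}"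
        using unique by blast
    qed auto
    also have "\<dots> = (\<Sum>l\<in>?S. CARD('a) - 1)"
      by (rule sum.cong) (auto simp: card_line card_Diff_singleton)
    finally show ?thesis using two_le_card_field[where 'a = 'a] by simp
  qed
qed (auto simp: card_line)

text \<open>A linear map carries the line through \<open>x\<close> and \<open>y\<close> onto the
  line through their images, provided these differ. Lines collapsed to a point drop out, so the
  number of lines cannot grow.\<close>

lemma radial_image_linear_subset:
  fixes T :: "'a::field ^ 'd \<Rightarrow> 'a ^ 'n"
  assumes "Vector_Spaces.linear (*s) (*s) T"
  shows "radial_image (T y) (T ` E) \<subseteq> (`) T ` radial_image y E"
proof
  interpret T: Vector_Spaces.linear "(*s)" "(*s)" T by fact
  fix L assume "L \<in> radial_image (T y) (T ` E)"
  then obtain x where x: "x \<in> E" "T x \<noteq> T y" "L = radial_projection (T y) (T x)"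
    unfolding radial_image_def by blast
  then have "x \<noteq> y" by blast
  have "L = T ` radial_projection y x"
    using x(2,3) \<open>x \<noteq> y\<close> by (simp add: radial_projection_eq image_image T.add T.scale T.diff)
  then show "L \<in> (`) T ` radial_image y E"
    unfolding radial_image_def using x(1) \<open>x \<noteq> y\<close> by blast
qed

section \<open>Random linear maps into a coordinate subspace\<close>

text \<open>The image stays in the original type, with the coordinates outside \<open>J\<close> set
  to 0, so its dimension \<open>card J\<close> may depend on a variable. Randomness means counting
  over all matrices \<open>A\<close>.\<close>

definition coord_map :: "'d set \<Rightarrow> 'a::field ^ 'd ^ 'd \<Rightarrow> 'a ^ 'd \<Rightarrow> 'a ^ 'd" where
  "coord_map J A v = (\<chi> i. if i \<in> J then (A *v v) $ i else 0)"

definition coord_subspace :: "'d set \<Rightarrow> ('a::field ^ 'd) set" where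
  "coord_subspace J = {v. \<forall>i. i \<notin> J \<longrightarrow> v $ i = 0}"

lemma linear_coord_map: "Vector_Spaces.linear (*s) (*s) (coord_map J A)"
  by unfold_locales
    (auto simp: coord_map_def vec_eq_iff matrix_vector_right_distrib vector_scalar_commute)

lemma coord_map_diff_left: "coord_map J (A - B) v = coord_map J A v - coord_map J B v"
  by (auto simp: coord_map_def vec_eq_iff matrix_vector_mult_diff_rdistrib)

lemma coord_map_add_left: "coord_map J (A + B) v = coord_map J A v + coord_map J B v"
  by (auto simp: coord_map_def vec_eq_iff matrix_vector_mult_add_rdistrib)

lemma coord_map_in: "coord_map J A v \<in> coord_subspace J"
  by (simp add: coord_map_def coord_subspace_def)

lemma subspace_coord_subspace: "vec.subspace (coord_subspace J)"
  by (auto simp: vec.subspace_def coord_subspace_def)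

lemma card_coord_subspace:
  "card (coord_subspace J :: ('a::{field, finite} ^ 'd) set) = CARD('a) ^ card J"
proof -
  have "bij_betw (\<lambda>v. restrict (($) v) J) (coord_subspace J :: ('a ^ 'd) set) (J \<rightarrow>\<^sub>E UNIV)"
    by (rule bij_betwI[where g = "\<lambda>f. \<chi> i. if i \<in> J then f i else 0"])
      (auto simp: coord_subspace_def vec_eq_iff fun_eq_iff PiE_def extensional_def restrict_def)
  then show ?thesis
    using bij_betw_same_card by (fastforce simp: card_PiE)
qed

lemma coord_map_surj:
  assumes "v \<noteq> 0" "w \<in> coord_subspace J"
  shows "\<exists>A. coord_map J A v = w"
proof -
  obtain j where j: "v $ j \<noteq> 0"
    using assms(1) by (auto simp: vec_eq_iff)
  \<comment> \<open>The only nonzero column is the one at \<open>j\<close>, namely \<open>w\<close>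
    divided by \<open>v $ j\<close>.\<close>
  have "coord_map J (\<chi> i l. if l = j then w $ i / v $ j else 0) v = w"
    using assms(2) j
    by (auto simp: coord_map_def coord_subspace_def vec_eq_iff matrix_vector_mult_def if_distrib
        [of "\<lambda>x. x * _"] cong: if_cong)
  then show ?thesis by blast
qed

text \<open>For fixed nonzero \<open>v\<close>, evaluation at \<open>v\<close> is additive in
  \<open>A\<close> and surjective, so its fibres are translates of the kernel. Thus a random map
  kills \<open>v\<close> with probability one over the size of the target.\<close>

lemma card_coord_map_kernel:
  fixes v :: "'a::{field, finite} ^ 'd"
  assumes "v \<noteq> 0"
  shows "card {A. coord_map J A v = 0} * CARD('a) ^ card J = CARD('a ^ 'd ^ 'd)"
proof -
  let ?W = "coord_subspace J :: ('a ^ 'd) set"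
  have fib: "card {A. coord_map J A v = w} = card {A. coord_map J A v = 0}" if w: "w \<in> ?W" for w
  proof -
    obtain A0 where A0: "coord_map J A0 v = w"
      using coord_map_surj[OF assms w] by blast
    have "bij_betw (\<lambda>A. A - A0) {A. coord_map J A v = w} {A. coord_map J A v = 0}"
      by (rule bij_betwI[where g = "\<lambda>A. A + A0"])
        (auto simp: coord_map_diff_left coord_map_add_left A0)
    then show ?thesis by (rule bij_betw_same_card)
  qed
  have "(UNIV :: ('a ^ 'd ^ 'd) set) = (\<Union>w\<in>?W. {A. coord_map J A v = w})"
    using coord_map_in by blast
  then have "CARD('a ^ 'd ^ 'd) = card (\<Union>w\<in>?W. {A. coord_map J A v = w})"
    by simp
  also have "\<dots> = (\<Sum>w\<in>?W. card {A. coord_map J A v = w})"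
    by (rule card_UN_disjoint) auto
  also have "\<dots> = card ?W * card {A. coord_map J A v = 0}"
    using fib by simp
  finally show ?thesis
    by (simp add: card_coord_subspace mult.commute)
qed

text \<open>Cauchy-Schwarz for the fibre sizes, whose squares add up to the number of colliding
  pairs.\<close>

lemma card_image_collisions:
  assumes "finite A"
  shows "(real (card A))\<^sup>2 \<le> real (card (f ` A)) * (\<Sum>x\<in>A. \<Sum>y\<in>A. of_bool (f x = f y))"
proof -
  have fib: "{z \<in> f ` A. f x = z \<and> f y = z} = (if f x = f y then {f x} else {})" if "x \<in> A" for x y
    using that by (auto; metis imageI)
  have "real (card A) = (\<Sum>z\<in>f ` A. real (card {x \<in> A. f x = z}))"
    using sum.group[of A "f ` A" f "\<lambda>_. 1 :: real"] assms by simp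
  then have "(real (card A))\<^sup>2 \<le> (\<Sum>z\<in>f ` A. (real (card {x \<in> A. f x = z}))\<^sup>2) * card (f ` A)"
    using sum_squared_le_sum_of_squares by metis
  also have "(\<Sum>z\<in>f ` A. (real (card {x \<in> A. f x = z}))\<^sup>2)
      = (\<Sum>x\<in>A. \<Sum>y\<in>A. real (card {z \<in> f ` A. f x = z \<and> f y = z}))"
    using assms by (intro sum_card_square) auto
  also have "\<dots> = (\<Sum>x\<in>A. \<Sum>y\<in>A. of_bool (f x = f y))"
    by (intro sum.cong refl) (auto simp: fib)
  finally show ?thesis by (simp add: mult.commute)
qed

text \<open>On average over \<open>A\<close>, the diagonal gives \<open>card S\<close> collisions,
  and the pairs of distinct points give at most \<open>card S\<close> more because \<open>S\<close>
  is no larger than the target.\<close>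

lemma sum_collisions_le:
  fixes S :: "('a::{field, finite} ^ 'd) set"
  assumes "card S \<le> CARD('a) ^ card J"
  shows "(\<Sum>A\<in>UNIV. \<Sum>x\<in>S. \<Sum>y\<in>S. of_bool (coord_map J A x = coord_map J A y))
    \<le> 2 * real (card S) * CARD('a ^ 'd ^ 'd)"
proof -
  let ?N = "real CARD('a ^ 'd ^ 'd)" and ?w = "real CARD('a) ^ card J"
  have pair: "(\<Sum>A\<in>UNIV. of_bool (coord_map J A x = coord_map J A y)) = ?N / ?w"
    if "x \<noteq> y" for x y :: "'a ^ 'd"
  proof -
    interpret T: Vector_Spaces.linear "(*s)" "(*s)" "coord_map J A" for A :: "'a ^ 'd ^ 'd"
      by (rule linear_coord_map)
    have "(\<Sum>A\<in>UNIV. of_bool (coord_map J A x = coord_map J A y))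
        = real (card {A. coord_map J A (x - y) = 0})"
      by (simp add: of_bool_def sum.If_cases T.diff)
    also have "real (card {A. coord_map J A (x - y) = 0}) * ?w = ?N"
      using card_coord_map_kernel[of "x - y" J] that
      by (metis eq_iff_diff_eq_0 of_nat_mult of_nat_power)
    then have "real (card {A. coord_map J A (x - y) = 0}) = ?N / ?w"
      by (simp add: field_simps)
    finally show ?thesis .
  qed
  have "(\<Sum>A\<in>UNIV. \<Sum>x\<in>S. \<Sum>y\<in>S. of_bool (coord_map J A x = coord_map J A y))
      = (\<Sum>x\<in>S. \<Sum>y\<in>S. \<Sum>A\<in>UNIV. of_bool (coord_map J A x = coord_map J A y) :: real)"
    by (subst sum.swap, intro sum.cong refl, subst sum.swap, rule refl)
  also have "\<dots> \<le> (\<Sum>x\<in>S. \<Sum>y\<in>S. (if x = y then ?N else 0) + ?N / ?w)"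
  proof (intro sum_mono)
    fix x y :: "'a ^ 'd"
    show "(\<Sum>A\<in>UNIV. of_bool (coord_map J A x = coord_map J A y)) \<le> (if x = y then ?N else 0) + ?N / ?w"
      using pair[of x y] by (cases "x = y") auto
  qed
  also have "\<dots> = card S * ?N + card S * (card S / ?w) * ?N"
    by (simp add: sum.distrib algebra_simps)
  also have "\<dots> \<le> card S * ?N + real (card S) * 1 * ?N"
  proof -
    have "real (card S) \<le> ?w"
      using assms by (metis of_nat_le_iff of_nat_power)
    then have "card S / ?w \<le> 1"
      by (simp add: divide_le_eq)
    then show ?thesis
      by (intro add_left_mono mult_right_mono mult_left_mono of_nat_0_le_iff)
  qed
  finally show ?thesis by (simp add: algebra_simps)
qed

text \<open>The collisions per point average at most 2 for each set, so for some \<open>A\<close>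
  the two ratios sum to at most 4. Both are then at most 4, and each image keeps a quarter of its
  set.\<close>

lemma ex_coord_map_large_images:
  fixes S S' :: "('a::{field, finite} ^ 'd) set"
  assumes "card S \<le> CARD('a) ^ card J" "card S' \<le> CARD('a) ^ card J"
    and ne: "S \<noteq> {}" "S' \<noteq> {}"
  obtains A where "card S \<le> 4 * card (coord_map J A ` S)" "card S' \<le> 4 * card (coord_map J A ` S')"
proof -
  define Q where "Q S A = (\<Sum>x\<in>S. \<Sum>y\<in>S. of_bool (coord_map J A x = coord_map J A y) :: real)"
    for S :: "('a ^ 'd) set" and A
  have pos: "0 < card S" "0 < card S'"
    using ne by (simp_all add: card_gt_0_iff)
  have Q0: "0 \<le> Q S A" for S A
    unfolding Q_def by (intro sum_nonneg) auto
  have mean: "(\<Sum>A\<in>UNIV. Q U A / card U) \<le> 2 * real CARD('a ^ 'd ^ 'd)"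
    if "card U \<le> CARD('a) ^ card J" "0 < card U" for U
    using sum_collisions_le[OF that(1)] that(2)
    unfolding Q_def sum_divide_distrib[symmetric] by (simp only: divide_le_eq of_nat_0_less_iff mult_ac if_True)
  have "(\<Sum>A\<in>UNIV. Q S A / card S + Q S' A / card S') \<le> (\<Sum>A\<in>(UNIV :: ('a ^ 'd ^ 'd) set). 4)"
    unfolding sum.distrib sum_constant
    using mean[OF assms(1) pos(1)] mean[OF assms(2) pos(2)] by linarith
  then obtain A where A: "Q S A / card S + Q S' A / card S' \<le> 4"
    by (metis (no_types, lifting) sum_strict_mono finite UNIV_not_empty not_le)
  have large: "card U \<le> 4 * card (coord_map J A ` U)" if "Q U A / card U \<le> 4" "0 < card U" for U
  proof -
    have "(real (card U))\<^sup>2 \<le> card (coord_map J A ` U) * Q U A"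
      unfolding Q_def by (intro card_image_collisions) simp
    also have "\<dots> \<le> real (card (coord_map J A ` U)) * (4 * card U)"
      using that by (intro mult_left_mono) (auto simp: field_simps)
    finally have "real (card U) \<le> 4 * card (coord_map J A ` U)"
      using that(2) by (simp add: power2_eq_square)
    then show ?thesis by linarith
  qed
  have "0 \<le> Q S A / card S" "0 \<le> Q S' A / card S'"
    using Q0 by auto
  with A show thesis
    using that large pos by (smt (verit))
qed

section \<open>The bound inside a subspace of dimension k + 1\<close>

lemma radial_image_blocks:
  fixes E :: "('a::field ^ 'd) set"
  assumes W: "vec.subspace W" and "E \<subseteq> W" "y \<in> W"
  shows "radial_image y E \<subseteq> {l \<in> {L. is_line L \<and> L \<subseteq> W}. y \<in> l}"
proof
  fix L assume "L \<in> radial_image y E"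
  then obtain x where x: "x \<in> W" "x \<noteq> y" "L = radial_projection y x"
    using assms(2) unfolding radial_image_def by blast
  have "radial_projection y x \<subseteq> W"
    using x assms by (intro radial_projection_subset)
  then show "L \<in> {l \<in> {L. is_line L \<and> L \<subseteq> W}. y \<in> l}"
    using radial_projection_line[OF x(2)] x(3) by blast
qed

text \<open>If \<open>y\<close> itself belongs to \<open>E\<close>, it has no projection of its own
  and is covered by the line of some other point; the hypothesis supplies such a point.\<close>

lemma radial_image_covers:
  fixes E :: "('a::field ^ 'd) set"
  assumes "\<not> E \<subseteq> {y}"
  shows "E \<subseteq> \<Union>(radial_image y E)"
proof
  fix x assume x: "x \<in> E"
  obtain z where z: "z \<in> E" "z \<noteq> y"
    using assms by blast
  show "x \<in> \<Union>(radial_image y E)"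
  proof (cases "x = y")
    case True
    with radial_projection_line[OF z(2)] z show ?thesis
      unfolding radial_image_def by blast
  next
    case False
    with radial_projection_line[OF False] x show ?thesis
      unfolding radial_image_def by blast
  qed
qed

text \<open>After cancelling \<open>y * e\<close>, the incidence bound reads 9/16
  \<open>y * e\<close> at most \<open>2 * n * M + 2 * n * y\<close>. Since \<open>e\<close> is at
  least 15/2 \<open>n\<close>, the last term is at most 4/15 \<open>y * e\<close>. Absorbing it
  leaves 71/240 \<open>y * e\<close>, and 480/71 is below 7.\<close>

lemma few_points_of_incidence_bound:
  fixes e y n M r :: real
  assumes "(y * e * (1 - M / n))\<^sup>2 \<le> (y * M + y\<^sup>2) * (e * r)"
    and "0 \<le> M" "M \<le> n / 4" "r \<le> 2 * n" "30 * n \<le> 4 * e" "0 < n" "0 < y"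
  shows "y * e \<le> 7 * n * M"
proof -
  have e: "0 < e" using assms by linarith
  have "3 / 4 \<le> 1 - M / n"
    using assms by (simp add: field_simps)
  then have "(y * e * (3 / 4))\<^sup>2 \<le> (y * e * (1 - M / n))\<^sup>2"
    using assms e by (intro power_mono mult_left_mono) auto
  also have "\<dots> \<le> (y * M + y\<^sup>2) * (e * r)" by fact
  also have "\<dots> \<le> (y * M + y\<^sup>2) * (e * (2 * n))"
    using assms e by (intro mult_left_mono) auto
  finally have "(y * e) * (9 / 16 * (y * e)) \<le> (y * e) * (2 * n * M + 2 * n * y)"
    by (simp add: algebra_simps power2_eq_square)
  then have "9 / 16 * (y * e) \<le> 2 * n * M + 2 * n * y"
    using assms e by simp
  moreover have "30 * n * y \<le> 4 * e * y"
    using assms by (intro mult_right_mono) auto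
  moreover have "0 \<le> n * M"
    using assms by simp
  ultimately show ?thesis
    by (simp add: algebra_simps)
qed

lemma card_mult_le_of_small_radial_images:
  fixes E Y W :: "('a::{field, finite} ^ 'd) set" and M :: real
  assumes W: "vec.subspace W" "card W = CARD('a) ^ (k + 1)"
    and E: "E \<subseteq> W" "30 * CARD('a) ^ k \<le> 4 * card E"
    and Y: "Y \<subseteq> W" "Y \<noteq> {}" "\<And>y. y \<in> Y \<Longrightarrow> card (radial_image y E) \<le> M"
    and M: "0 \<le> M" "M \<le> real CARD('a) ^ k / 4"
  shows "real (card Y) * card E \<le> 7 * real CARD('a) ^ k * M"
proof -
  define q where "q = CARD('a)"
  define r where "r = (card W - 1) div (q - 1)"
  interpret regular_linear_space W "{L. is_line L \<and> L \<subseteq> W}" q r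
    unfolding q_def r_def using W(1) by (rule regular_linear_space_subspace)
  have q: "2 \<le> q"
    unfolding q_def by (rule two_le_card_field)
  have qk: "1 \<le> q ^ k"
    using q by simp
  \<comment> \<open>The degree \<open>r\<close> is the geometric sum of the powers of
    \<open>q\<close> up to \<open>q ^ k\<close>; only the bounds \<open>q ^ k\<close> and
    \<open>2 * q ^ k\<close> are extracted.\<close>
  have "q ^ k * (q - 1) \<le> card W - 1"
    unfolding W(2) q_def[symmetric] using qk by (simp add: diff_mult_distrib2 mult.commute)
  then have "q ^ k \<le> r"
    unfolding r_def using q by (simp add: less_eq_div_iff_mult_less_eq)
  then have r1: "card W \<le> q * r"
    using W(2) by (simp add: q_def)
  have "r * (q - 1) \<le> card W - 1"
    unfolding r_def by (rule div_times_less_eq_dividend)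
  also have "\<dots> \<le> q * q ^ k"
    using W(2) by (simp add: q_def)
  also have "\<dots> \<le> (2 * q ^ k) * (q - 1)"
    using q by (cases q) auto
  finally have r2: "r \<le> 2 * q ^ k"
    using q by simp
  have cE: "2 \<le> card E"
    using E(2) qk unfolding q_def by linarith
  have nsub: "\<not> E \<subseteq> {y}" for y
    using cE card_mono[of "{y}" E] by auto
  have Wq: "M * q / card W = M / real q ^ k"
    using W(2) q by (simp add: q_def)
  have "(real (card Y) * card E * (1 - M * q / card W))\<^sup>2
      \<le> (card Y * M + (real (card Y))\<^sup>2) * (real (card E) * r)"
  proof (rule few_blocks_cover[where F = "\<lambda>y. radial_image y E"])
    show "radial_image y E \<subseteq> {l \<in> {L. is_line L \<and> L \<subseteq> W}. y \<in> l}" if "y \<in> Y" for y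
      using that W(1) E(1) Y(1) by (intro radial_image_blocks) auto
    show "M * q \<le> card W"
    proof -
      have "M \<le> real q ^ k"
        using M by (simp add: q_def)
      then show ?thesis
        using W(2) by (simp add: q_def)
    qed
    show "E \<subseteq> \<Union>(radial_image y E)" for y
      using nsub by (rule radial_image_covers)
  qed (use E Y M r1 in auto)
  then show ?thesis
    unfolding Wq q_def[symmetric]
  proof (rule few_points_of_incidence_bound)
    show "real r \<le> 2 * real q ^ k"
      using of_nat_mono[OF r2, where 'a = real] by simp
    show "30 * real q ^ k \<le> 4 * real (card E)"
      using of_nat_mono[OF E(2), where 'a = real] by (simp add: q_def)
  qed (use M q Y(2) in \<open>auto simp: q_def card_gt_0_iff\<close>)
qed

section \<open>Reduction of the general case to dimension k + 1\<close>

theorem theorem1p2: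
  fixes E :: "('a::{field, finite} ^ 'd) set" and q d k :: nat and M :: int
  assumes "CARD('a) = q" and "CARD('d) = d"
    and "k \<in> {1..d - 1}"
    and "30 * q ^ k \<le> card E" and "card E \<le> q ^ (k + 1)"
    and "real (card E) / real q \<le> real_of_int M"
    and "real_of_int M \<le> real q ^ k / 4"
  shows "real (card {y. int (card (radial_image y E)) \<le> M})
           < 300 * real q ^ k * real_of_int M / real (card E)"
proof (rule ccontr)
  define Y where "Y = {y. int (card (radial_image y E)) \<le> M}"
  define b where "b = 300 * real q ^ k * real_of_int M / real (card E)"
  assume "\<not> ?thesis"
  then have bY: "b \<le> card Y"
    by (simp add: Y_def b_def)
  have q: "0 < q"
    using assms(1) by auto
  have E30: "30 * real q ^ k \<le> card E"
    using of_nat_mono[OF assms(4), where 'a = real] by simp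
  have qk: "1 \<le> real q ^ k"
    using q by simp
  have cE: "0 < real (card E)"
    using E30 qk by linarith
  have M: "0 < real_of_int M"
    using assms(6) q cE by (smt (verit) divide_pos_pos of_nat_0_less_iff)
  have b0: "0 < b"
    unfolding b_def using M q cE by (intro divide_pos_pos mult_pos_pos) simp_all
  \<comment> \<open>The critical size is at most 5/2 \<open>q ^ k\<close>, so even rounded up it
    stays below \<open>card E\<close> and hence fits into the projected space.\<close>
  have "b \<le> 300 * real q ^ k * (real q ^ k / 4) / (30 * real q ^ k)"
    unfolding b_def using assms(7) E30 M q qk by (intro frac_le mult_left_mono) auto
  also have "\<dots> = 5 / 2 * real q ^ k"
    using q by simp
  finally have b1: "b + 1 \<le> card E"
    using E30 qk by linarith
  (* Y itself may be larger than q ^ (k + 1), and then most of its points could be identified by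
     every projection; a subset of the critical size b suffices. *)
  define N where "N = nat \<lceil>b\<rceil>"
  have "N \<le> card Y"
    unfolding N_def using bY by linarith
  then obtain Y0 where Y0: "Y0 \<subseteq> Y" "card Y0 = N"
    by (rule obtain_subset_with_card_n)
  have N: "b \<le> N" "0 < N" "N \<le> card E"
    unfolding N_def using b0 b1 by linarith+
  have "k + 1 \<le> CARD('d)"
    using assms(2,3) by auto
  then obtain J :: "'d set" where J: "card J = k + 1"
    by (rule obtain_subset_with_card_n)
  have le: "card E \<le> CARD('a) ^ card J" "card Y0 \<le> CARD('a) ^ card J"
    unfolding assms(1) J Y0(2) using assms(5) N(3) by linarith+
  have ne: "E \<noteq> {}" "Y0 \<noteq> {}"
    using cE Y0(2) N(2) by auto
  obtain A where A: "card E \<le> 4 * card (coord_map J A ` E)" "card Y0 \<le> 4 * card (coord_map J A ` Y0)"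
    using ex_coord_map_large_images[OF le ne] .
  let ?T = "coord_map J A" and ?W = "coord_subspace J :: ('a ^ 'd) set"
  have "real (card (?T ` Y0)) * card (?T ` E) \<le> 7 * real CARD('a) ^ k * M"
  proof (rule card_mult_le_of_small_radial_images[where W = ?W])
    show "vec.subspace ?W"
      by (rule subspace_coord_subspace)
    show "card ?W = CARD('a) ^ (k + 1)"
      by (simp add: card_coord_subspace J)
    show "?T ` E \<subseteq> ?W" "?T ` Y0 \<subseteq> ?W"
      using coord_map_in by blast+
    show "30 * CARD('a) ^ k \<le> 4 * card (?T ` E)"
      unfolding assms(1) using A(1) assms(4) by linarith
    show "?T ` Y0 \<noteq> {}"
      using ne(2) by simp
    show "real (card (radial_image y (?T ` E))) \<le> real_of_int M" if y: "y \<in> ?T ` Y0" for y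
    proof -
      obtain z where z: "z \<in> Y0" "y = ?T z"
        using y by blast
      have "card (radial_image y (?T ` E)) \<le> card ((`) ?T ` radial_image z E)"
        unfolding z(2) by (intro card_mono radial_image_linear_subset linear_coord_map) simp
      also have "\<dots> \<le> card (radial_image z E)"
        by (rule card_image_le) simp
      finally show ?thesis
        using z(1) Y0(1) unfolding Y_def by fastforce
    qed
  qed (use M assms(1,7) in auto)
  then have up: "real (card (?T ` Y0)) * card (?T ` E) \<le> 7 * (real q ^ k * M)"
    by (simp add: assms(1))
  \<comment> \<open>Each of the two sets loses at most a factor 4, and 300/16 still exceeds the
    constant 7, which gives the contradiction.\<close>
  have "b / 4 \<le> real (card (?T ` Y0))" "real (card E) / 4 \<le> real (card (?T ` E))"
    using A N(1) Y0(2) by linarith+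
  then have "b / 4 * (real (card E) / 4) \<le> real (card (?T ` Y0)) * card (?T ` E)"
    using b0 by (intro mult_mono) auto
  moreover have "b / 4 * (real (card E) / 4) = 300 / 16 * (real q ^ k * M)"
    using cE ne(1) by (simp add: b_def)
  moreover have "0 < real q ^ k * M"
    using q M by simp
  ultimately show False
    using up by linarith
qed

end
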